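(* Let $\vec x\in X$ be an eigenvector of the graph $1$-Laplacian of a connected graph $G$, let $\mu=I(\vec x)$, and let $D^+_1,\dots,D^+_{r^+}$ and $D^-_1,\dots,D^-_{r^-}$ be its positive and negative nodal domains. Then for every $\alpha\in\{1,\dots,r^+\}$ one has $\vec x\simeq\hat{\vec 1}_{D^+_\alpha}$ in $S(G)\cap I^{-1}(\mu)$, and for every $\beta\in\{1,\dots,r^-\}$ one has $\vec x\simeq\hat{\vec 1}_{D^-_\beta}$ in $S(G)\cap I^{-1}(\mu)$. That is, in each case there is a path $l(t)$, $t\in[0,1]$, in $X$ with $l(0)=\vec x$ and $l(1)=\hat{\vec 1}_{D^+_\alpha}$ (respectively $l(1)=\hat{\vec 1}_{D^-_\beta}$), such that for every $t\in[0,1]$ the vector $l(t)$ is an eigenvector of the $1$-Laplacian of $G$ and $I(l(t))=\mu$.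
   Context: $G=(V,E)$ is a finite simple undirected connected graph, $V=\{1,\dots,n\}$, $n\ge 2$; $d_i$ is the degree of $i$; $j\sim i$ means adjacency; $\mathrm{vol}(A)=\sum_{i\in A}d_i$. $\mathrm{Sgn}(t)=\{1\}$ if $t>0$, $\{-1\}$ if $t<0$, $[-1,1]$ if $t=0$. $I(\vec x)=\sum_{\{i,j\}\in E}|x_i-x_j|$ and $X=\{\vec x\in\mathbb R^n:\sum_i d_i|x_i|=1\}$. A nonzero $\vec x\in\mathbb R^n$ is an eigenvector of the $1$-Laplacian with eigenvalue $\mu\in\mathbb R$ if there exist numbers $z_{ij}\in\mathrm{Sgn}(x_i-x_j)$ with $z_{ji}=-z_{ij}$ (for all adjacent $i,j$) such that $\sum_{j\sim i}z_{ij}\in\mu d_i\,\mathrm{Sgn}(x_i)$ for all $i\in V$. $S(G)$ denotes the set of all eigenvectors of the $1$-Laplacian of $G$. For a set $A\subset X$, $\vec x\simeq\vec y$ in $A$ means that there is a path $l(t)$ in $X$ with $l(0)=\vec x$, $l(1)=\vec y$ and $l(t)\in A$ for all $t\in[0,1]$. The positive (negative) nodal domains of $\vec x$ are the vertex sets of the connected components of the subgraph induced on $\{i:x_i>0\}$ ($\{i:x_i<0\}$). For nonempty $D\subset V$, $\vec 1_D$ is the indicator vector of $D$ and $\hat{\vec 1}_D=\vec 1_D/\mathrm{vol}(D)$.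
   Formalization: For negative nodal domains the endpoint is minus the normalized indicator of D^-_β, not plus as printed; the printed claim fails for x = -1_V/vol(V), where μ = 0 and the level set in X is just the two points ±1_V/vol(V). *)

theory Defs
  imports "HOL-Analysis.Analysis" "Graph_Theory.Digraph_Component"
begin

text \<open>
  Graphs are those of the Graph Theory entry: the locale \<open>graph\<close> is a finite loop-free symmetric
  digraph without parallel arcs, so each undirected edge is represented by its two orientations.
  Vectors are indexed by the type \<open>'n\<close>, which is the whole vertex set.
\<close>

definition degree :: "('n, 'b) pre_digraph \<Rightarrow> 'n \<Rightarrow> nat" where
  "degree G i = out_degree G i"

definition vol :: "('n, 'b) pre_digraph \<Rightarrow> 'n set \<Rightarrow> real" where
  "vol G A = (\<Sum>i\<in>A. real (degree G i))"

definition Sgn :: "real \<Rightarrow> real set" where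
  "Sgn t = (if t > 0 then {1} else if t < 0 then {-1} else {-1..1})"

text \<open>The factor one half compensates for counting both orientations of each edge.\<close>

definition tvar :: "('n::finite, 'b) pre_digraph \<Rightarrow> real ^ 'n \<Rightarrow> real" where
  "tvar G x = (\<Sum>e\<in>arcs G. \<bar>x $ tail G e - x $ head G e\<bar>) / 2"

definition unit_set :: "('n::finite, 'b) pre_digraph \<Rightarrow> (real ^ 'n) set" where
  "unit_set G = {x. (\<Sum>i\<in>UNIV. real (degree G i) * \<bar>x $ i\<bar>) = 1}"

definition eigenpair :: "('n::finite, 'b) pre_digraph \<Rightarrow> real \<Rightarrow> real ^ 'n \<Rightarrow> bool" where
  "eigenpair G \<mu> x \<longleftrightarrow> x \<noteq> 0 \<and>
    (\<exists>z :: 'n \<Rightarrow> 'n \<Rightarrow> real.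
      (\<forall>i j. i \<rightarrow>\<^bsub>G\<^esub> j \<longrightarrow> z i j \<in> Sgn (x $ i - x $ j) \<and> z j i = - z i j) \<and>
      (\<forall>i. (\<Sum>j | j \<rightarrow>\<^bsub>G\<^esub> i. z i j) \<in> (\<lambda>s. \<mu> * real (degree G i) * s) ` Sgn (x $ i)))"

definition eigenvectors :: "('n::finite, 'b) pre_digraph \<Rightarrow> (real ^ 'n) set" where
  "eigenvectors G = {x. \<exists>\<mu>. eigenpair G \<mu> x}"

definition path_equiv ::
  "('n::finite, 'b) pre_digraph \<Rightarrow> (real ^ 'n) set \<Rightarrow> real ^ 'n \<Rightarrow> real ^ 'n \<Rightarrow> bool" where
  "path_equiv G A x y \<longleftrightarrow>
    (\<exists>l. path l \<and> path_image l \<subseteq> unit_set G \<and> l 0 = x \<and> l 1 = y \<and> (\<forall>t\<in>{0..1}. l t \<in> A))"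

text \<open>
  Connected components are the maximal connected subgraphs; \<open>Digraph_Component.connected\<close> requires
  a nonempty vertex set.
\<close>

definition components :: "('n, 'b) pre_digraph \<Rightarrow> 'n set set" where
  "components H = {verts C | C. pre_digraph.max_subgraph H Digraph_Component.connected C}"

definition pos_nodal_domains :: "('n::finite, 'b) pre_digraph \<Rightarrow> real ^ 'n \<Rightarrow> 'n set set" where
  "pos_nodal_domains G x = components (G \<restriction> {i. x $ i > 0})"

definition neg_nodal_domains :: "('n::finite, 'b) pre_digraph \<Rightarrow> real ^ 'n \<Rightarrow> 'n set set" where
  "neg_nodal_domains G x = components (G \<restriction> {i. x $ i < 0})"

text \<open>
  \<open>hat_indicator G D\<close> is nonnegative whichever way \<open>D\<close> arises, so the endpoint associated with a
  negative nodal domain \<open>D\<close> is \<open>- hat_indicator G D\<close>. The minus sign, absent from the printed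
  statement, is needed: on any connected graph with at least two vertices, \<open>x = - hat_indicator G UNIV\<close>
  is an eigenvector with eigenvalue 0 and negative nodal domain \<open>UNIV\<close>, while the level set of
  \<open>tvar G\<close> at 0 within \<open>unit_set G\<close> consists of the two points \<open>x\<close> and \<open>- x\<close>.
\<close>

definition hat_indicator :: "('n::finite, 'b) pre_digraph \<Rightarrow> 'n set \<Rightarrow> real ^ 'n" where
  "hat_indicator G D = (\<chi> i. indicator D i / vol G D)"

end

theory Submission
  imports Defs
begin

text \<open>
  The path is the straight segment. The point is that one multiplier family serves both endpoints:
  if \<open>z\<close> and \<open>s\<close> witness the eigenvector equation for \<open>x\<close> and \<open>D\<close> is a nodal domain, then every edge
  leaving \<open>D\<close> carries \<open>z = \<plusminus>1\<close> and \<open>s = \<plusminus>1\<close> on \<open>D\<close>, so the same \<open>z\<close> and \<open>s\<close> witness the equation for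
  the signed indicator of \<open>D\<close> with the same \<open>\<mu>\<close>. The condition \<open>z \<in> Sgn t\<close> for fixed \<open>z\<close> is
  stable under convex combinations of the arguments \<open>t\<close>, so they serve the whole segment. Pairing the equation
  with the vector shows that the eigenvalue of a normalised eigenvector is its total variation.
\<close>

section \<open>Signs as subgradients of the absolute value\<close>

lemma in_Sgn_iff: "r \<in> Sgn t \<longleftrightarrow> \<bar>r\<bar> \<le> 1 \<and> r * t = \<bar>t\<bar>"
proof (cases t "0 :: real" rule: linorder_cases)
  case less
  then have "r * t = - t \<longleftrightarrow> r = - 1"
    using mult_cancel_right[of r t "- 1"] by simp
  with less show ?thesis by (auto simp: Sgn_def)
qed (auto simp: Sgn_def)

text \<open>For |r| \<le> 1 the linear function \<open>r * t\<close> never exceeds |t|. If both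
  agree at two points, the triangle inequality forces agreement at every convex combination.\<close>

lemma Sgn_convex:
  assumes "r \<in> Sgn a" "r \<in> Sgn b" "0 \<le> t" "t \<le> 1"
  shows "r \<in> Sgn ((1 - t) * a + t * b)"
proof -
  have r: "\<bar>r\<bar> \<le> 1" "r * a = \<bar>a\<bar>" "r * b = \<bar>b\<bar>"
    using assms by (auto simp: in_Sgn_iff)
  have "r * ((1 - t) * a + t * b) = (1 - t) * (r * a) + t * (r * b)"
    by (simp add: algebra_simps)
  also have "\<dots> = \<bar>(1 - t) * a\<bar> + \<bar>t * b\<bar>"
    using assms r by (simp add: abs_mult)
  finally have "r * ((1 - t) * a + t * b) \<ge> \<bar>(1 - t) * a + t * b\<bar>"
    by linarith
  moreover have "r * c \<le> \<bar>c\<bar>" for c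
    using mult_right_mono[OF r(1), of "\<bar>c\<bar>"] abs_ge_self[of "r * c"] by (simp add: abs_mult)
  ultimately show ?thesis
    using r(1) by (simp add: in_Sgn_iff order_antisym)
qed

section \<open>Multiplier witnesses and convexity\<close>

text \<open>Both multipliers are explicit, including the sign \<open>s\<close> that
  \<open>eigenpair\<close> hides in an image, so that several vectors can share them.\<close>

definition eigen_witness ::
  "('n::finite, 'b) pre_digraph \<Rightarrow> real \<Rightarrow> ('n \<Rightarrow> 'n \<Rightarrow> real) \<Rightarrow> ('n \<Rightarrow> real) \<Rightarrow> real ^ 'n \<Rightarrow> bool" where
  "eigen_witness G \<mu> z s x \<longleftrightarrow>
    (\<forall>i j. i \<rightarrow>\<^bsub>G\<^esub> j \<longrightarrow> z i j \<in> Sgn (x $ i - x $ j) \<and> z j i = - z i j) \<and>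
    (\<forall>i. s i \<in> Sgn (x $ i) \<and> (\<Sum>j | j \<rightarrow>\<^bsub>G\<^esub> i. z i j) = \<mu> * real (degree G i) * s i)"

lemma eigenpair_iff_witness:
  "eigenpair G \<mu> x \<longleftrightarrow> x \<noteq> 0 \<and> (\<exists>z s. eigen_witness G \<mu> z s x)"
proof -
  have "(\<forall>i. (\<Sum>j | j \<rightarrow>\<^bsub>G\<^esub> i. z i j) \<in> (\<lambda>s. \<mu> * real (degree G i) * s) ` Sgn (x $ i)) \<longleftrightarrow>
      (\<exists>s. \<forall>i. s i \<in> Sgn (x $ i) \<and> (\<Sum>j | j \<rightarrow>\<^bsub>G\<^esub> i. z i j) = \<mu> * real (degree G i) * s i)" for z
    unfolding image_iff Bex_def by (rule choice_iff)
  then show ?thesis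
    by (simp only: eigenpair_def eigen_witness_def ex_simps)
qed

text \<open>The balance equation mentions only \<open>z\<close> and \<open>s\<close>; the vector
  enters through the sign conditions alone, and these are convex.\<close>

lemma eigen_witness_convex:
  assumes "eigen_witness G \<mu> z s x" "eigen_witness G \<mu> z s y" "0 \<le> t" "t \<le> 1"
  shows "eigen_witness G \<mu> z s ((1 - t) *\<^sub>R x + t *\<^sub>R y)"
proof -
  have "z i j \<in> Sgn (((1 - t) *\<^sub>R x + t *\<^sub>R y) $ i - ((1 - t) *\<^sub>R x + t *\<^sub>R y) $ j)"
    if "i \<rightarrow>\<^bsub>G\<^esub> j" for i j
    using Sgn_convex[of "z i j" "x $ i - x $ j" "y $ i - y $ j" t] assms that
    by (simp add: eigen_witness_def algebra_simps)
  moreover have "s i \<in> Sgn (((1 - t) *\<^sub>R x + t *\<^sub>R y) $ i)" for i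
    using Sgn_convex[of "s i" "x $ i" "y $ i" t] assms by (simp add: eigen_witness_def)
  ultimately show ?thesis
    using assms(1) unfolding eigen_witness_def by blast
qed

text \<open>A fixed \<open>s\<close> turns the weighted l1 norm into a linear functional, so
  \<open>unit_set\<close> becomes an affine condition on vectors sharing \<open>s\<close>.\<close>

lemma unit_set_iff_witness:
  assumes "eigen_witness G \<mu> z s x"
  shows "x \<in> unit_set G \<longleftrightarrow> (\<Sum>i\<in>UNIV. real (degree G i) * s i * x $ i) = 1"
proof -
  have "\<bar>x $ i\<bar> = s i * x $ i" for i
    using assms by (simp add: eigen_witness_def in_Sgn_iff)
  then show ?thesis by (simp add: unit_set_def mult.assoc)
qed

lemma unit_set_convex:
  assumes "eigen_witness G \<mu> z s x" "eigen_witness G \<mu> z s y" "0 \<le> t" "t \<le> 1"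
    and "x \<in> unit_set G" "y \<in> unit_set G"
  shows "(1 - t) *\<^sub>R x + t *\<^sub>R y \<in> unit_set G"
proof -
  let ?d = "\<lambda>x. \<Sum>i\<in>UNIV. real (degree G i) * s i * x $ i"
  have "?d ((1 - t) *\<^sub>R x + t *\<^sub>R y) = (1 - t) * ?d x + t * ?d y"
    unfolding sum_distrib_left sum.distrib[symmetric]
    by (intro sum.cong) (simp_all add: algebra_simps)
  also have "\<dots> = 1"
    using assms unit_set_iff_witness[OF assms(1)] unit_set_iff_witness[OF assms(2)] by simp
  finally show ?thesis
    using unit_set_iff_witness[OF eigen_witness_convex[OF assms(1-4)]] by simp
qed

lemma unit_set_nonzero: "x \<in> unit_set G \<Longrightarrow> x \<noteq> 0"
  by (auto simp: unit_set_def)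

section \<open>The eigenvalue as total variation\<close>

text \<open>Without parallel arcs an arc is determined by its ends, so the sum can run over the
  ordered pairs that index \<open>z\<close>.\<close>

lemma tvar_arcs_ends:
  fixes G :: "('n::finite, 'b) pre_digraph"
  assumes "graph G"
  shows "tvar G x = (\<Sum>(i, j)\<in>arcs_ends G. \<bar>x $ i - x $ j\<bar>) / 2"
proof -
  interpret graph G by fact
  have "inj_on (arc_to_ends G) (arcs G)"
    using no_multi_arcs by (auto intro: inj_onI)
  then show ?thesis
    by (simp add: tvar_def arcs_ends_def sum.reindex) (simp add: arc_to_ends_def)
qed

lemma eigenvalue_eq_tvar:
  fixes G :: "('n::finite, 'b) pre_digraph"
  assumes "graph G"
    and w: "eigen_witness G \<mu> z s x" and u: "x \<in> unit_set G"
  shows "tvar G x = \<mu>"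
proof -
  interpret graph G by fact
  let ?A = "arcs_ends G"
  have swap: "(\<Sum>(i, j)\<in>?A. f j i) = (\<Sum>(i, j)\<in>?A. f i j)" for f :: "'n \<Rightarrow> 'n \<Rightarrow> real"
    by (rule sum.reindex_bij_witness[of _ prod.swap prod.swap])
       (auto intro: graph_symmetric)
  have z: "z i j * (x $ i - x $ j) = \<bar>x $ i - x $ j\<bar>" "z j i = - z i j" if "i \<rightarrow>\<^bsub>G\<^esub> j" for i j
    using w that by (auto simp: eigen_witness_def in_Sgn_iff)
  have sum_z: "(\<Sum>j | j \<rightarrow>\<^bsub>G\<^esub> i. z i j) = \<mu> * real (degree G i) * s i" for i
    using w unfolding eigen_witness_def by blast
  have "\<mu> = \<mu> * (\<Sum>i\<in>UNIV. real (degree G i) * s i * x $ i)"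
    using u unit_set_iff_witness[OF w] by simp
  also have "\<dots> = (\<Sum>i\<in>UNIV. (\<Sum>j | j \<rightarrow>\<^bsub>G\<^esub> i. z i j) * x $ i)"
    using sum_z by (simp only: sum_distrib_left mult.assoc)
  also have "\<dots> = (\<Sum>i\<in>UNIV. \<Sum>j | j \<rightarrow>\<^bsub>G\<^esub> i. z i j * x $ i)"
    by (simp add: sum_distrib_right)
  also have "\<dots> = (\<Sum>(i, j)\<in>(SIGMA i:UNIV. {j. j \<rightarrow>\<^bsub>G\<^esub> i}). z i j * x $ i)"
    by (rule sum.Sigma) auto
  \<comment> \<open>The balance equation sums over arcs into \<open>i\<close>; symmetry of the graph
    turns them into arcs out of \<open>i\<close>.\<close>
  also have "(SIGMA i:UNIV. {j. j \<rightarrow>\<^bsub>G\<^esub> i}) = ?A"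
    by (auto intro: graph_symmetric)
  finally have \<mu>: "\<mu> = (\<Sum>(i, j)\<in>?A. z i j * x $ i)" .
  \<comment> \<open>Antisymmetry of \<open>z\<close> splits each summand into two terms that arc
    reversal exchanges, so each sums to \<open>\<mu>\<close>.\<close>
  have "2 * tvar G x = (\<Sum>(i, j)\<in>?A. z i j * x $ i + z j i * x $ j)"
    unfolding tvar_arcs_ends[OF assms(1)] using z by (auto intro!: sum.cong simp: right_diff_distrib)
  also have "\<dots> = \<mu> + (\<Sum>(i, j)\<in>?A. z j i * x $ j)"
    by (simp add: \<mu> sum.distrib case_prod_unfold)
  also have "\<dots> = 2 * \<mu>"
    using swap[of "\<lambda>i j. z i j * x $ i"] by (simp add: \<mu>)
  finally show ?thesis by simp
qed

text \<open>The shared witness fixes \<open>\<mu>\<close> along the segment, and on unit vectors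
  \<open>\<mu>\<close> equals \<open>tvar\<close>.\<close>

lemma segment_path_equiv:
  fixes G :: "('n::finite, 'b) pre_digraph"
  assumes "graph G"
    and x: "eigen_witness G \<mu> z s x" "x \<in> unit_set G"
    and y: "eigen_witness G \<mu> z s y" "y \<in> unit_set G"
  shows "path_equiv G (eigenvectors G \<inter> tvar G -` {\<mu>}) x y"
proof -
  interpret graph G by fact
  have *: "(1 - t) *\<^sub>R x + t *\<^sub>R y \<in> unit_set G \<inter> (eigenvectors G \<inter> tvar G -` {\<mu>})"
    if "t \<in> {0..1}" for t
  proof -
    have w: "eigen_witness G \<mu> z s ((1 - t) *\<^sub>R x + t *\<^sub>R y)"
      using eigen_witness_convex x y that by auto
    moreover have u: "(1 - t) *\<^sub>R x + t *\<^sub>R y \<in> unit_set G"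
      using unit_set_convex[OF x(1) y(1)] x y that by auto
    ultimately show ?thesis
      using eigenvalue_eq_tvar[OF assms(1)] unit_set_nonzero[OF u]
      by (auto simp: eigenvectors_def eigenpair_iff_witness)
  qed
  show ?thesis
    unfolding path_equiv_def
  proof (intro exI[of _ "linepath x y"] conjI)
    show "path_image (linepath x y) \<subseteq> unit_set G"
      using * by (auto simp: path_image_def linepath_def)
    show "\<forall>t\<in>{0..1}. linepath x y t \<in> eigenvectors G \<inter> tvar G -` {\<mu>}"
      using * by (auto simp: linepath_def)
  qed (simp_all add: linepath_0' linepath_1')
qed

section \<open>Signed indicators of nodal domains\<close>

text \<open>The sign \<open>\<sigma>\<close> treats positive and negative domains at once. Where the
  indicator difference vanishes, |z| \<le> 1 suffices; across the boundary of \<open>D\<close>,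
  \<open>x\<close> changes strictly and in the direction of the signed indicator.\<close>

lemma eigen_witness_signed_indicator:
  assumes w: "eigen_witness G \<mu> z s x" and \<sigma>: "\<sigma> = 1 \<or> \<sigma> = -1"
    and pos: "\<And>i. i \<in> D \<Longrightarrow> \<sigma> * x $ i > 0"
    and bdry: "\<And>i j. i \<in> D \<Longrightarrow> j \<notin> D \<Longrightarrow> i \<rightarrow>\<^bsub>G\<^esub> j \<or> j \<rightarrow>\<^bsub>G\<^esub> i \<Longrightarrow> \<sigma> * x $ j \<le> 0"
  shows "eigen_witness G \<mu> z s (\<sigma> *\<^sub>R hat_indicator G D)"
proof -
  have vol: "vol G D \<ge> 0"
    by (simp add: vol_def sum_nonneg)
  \<comment> \<open>Here \<open>r = \<sigma>\<close> is forced. Allowing \<open>c = 0\<close> covers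
    \<open>vol G D = 0\<close>, where \<open>1 / vol G D\<close> is 0.\<close>
  have Sgn_transfer: "r \<in> Sgn (\<sigma> * c)" if "r \<in> Sgn t" "\<sigma> * t > 0" "c \<ge> 0" for r t c
    using that \<sigma> by (auto simp: Sgn_def split: if_splits)
  have "z i j \<in> Sgn ((\<sigma> *\<^sub>R hat_indicator G D) $ i - (\<sigma> *\<^sub>R hat_indicator G D) $ j)"
    if e: "i \<rightarrow>\<^bsub>G\<^esub> j" for i j
  proof -
    have z: "z i j \<in> Sgn (x $ i - x $ j)"
      using w e by (simp add: eigen_witness_def)
    then have "\<bar>z i j\<bar> \<le> 1" and neg: "- z i j \<in> Sgn (x $ j - x $ i)"
      by (auto simp: in_Sgn_iff algebra_simps)
    consider "i \<in> D \<longleftrightarrow> j \<in> D" | "i \<in> D" "j \<notin> D" | "i \<notin> D" "j \<in> D" by blast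
    then show ?thesis
    proof cases
      case 1
      then show ?thesis
        using \<open>\<bar>z i j\<bar> \<le> 1\<close> by (simp add: hat_indicator_def indicator_def in_Sgn_iff)
    next
      case 2
      then have "\<sigma> * (x $ i - x $ j) > 0"
        using pos[of i] bdry[of i j] e by (simp add: right_diff_distrib)
      from Sgn_transfer[OF z this, of "1 / vol G D"] show ?thesis
        using 2 vol by (simp add: hat_indicator_def)
    next
      case 3
      then have "\<sigma> * (x $ j - x $ i) > 0"
        using pos[of j] bdry[of j i] e by (simp add: right_diff_distrib)
      from Sgn_transfer[OF neg this, of "1 / vol G D"] show ?thesis
        using 3 vol by (simp add: hat_indicator_def in_Sgn_iff)
    qed
  qed
  moreover have "s i \<in> Sgn ((\<sigma> *\<^sub>R hat_indicator G D) $ i)" for i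
  proof (cases "i \<in> D")
    case True
    then show ?thesis
      using Sgn_transfer[of "s i" "x $ i" "1 / vol G D"] pos[of i] vol w
      by (simp add: hat_indicator_def eigen_witness_def)
  next
    case False
    then show ?thesis
      using w by (simp add: hat_indicator_def eigen_witness_def in_Sgn_iff)
  qed
  ultimately show ?thesis
    using w unfolding eigen_witness_def by blast
qed

lemma signed_indicator_in_unit_set:
  assumes "\<bar>\<sigma>\<bar> = 1" "vol G D > 0"
  shows "\<sigma> *\<^sub>R hat_indicator G D \<in> unit_set G"
proof -
  have "(\<Sum>i\<in>UNIV. real (degree G i) * \<bar>(\<sigma> *\<^sub>R hat_indicator G D) $ i\<bar>)
      = (\<Sum>i\<in>UNIV. if i \<in> D then real (degree G i) / vol G D else 0)"
    using assms by (intro sum.cong) (auto simp: hat_indicator_def abs_mult)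
  also have "\<dots> = (\<Sum>i\<in>D. real (degree G i) / vol G D)"
    by (simp flip: sum.inter_restrict)
  also have "\<dots> = 1"
    using assms by (simp add: vol_def flip: sum_divide_distrib)
  finally show ?thesis by (simp add: unit_set_def)
qed

section \<open>Nodal domains and reachability\<close>

lemma strongly_connected_imp_connected:
  assumes "strongly_connected H" shows "Digraph_Component.connected H"
proof -
  have "(u, v) \<in> rtrancl_on (verts H) ((arcs_ends H)\<^sup>s)" if "u \<in> verts H" "v \<in> verts H" for u v
  proof -
    have "(u, v) \<in> rtrancl_on (verts H) (arcs_ends H)"
      using assms that by (auto simp: strongly_connected_def reachable_def)
    then show ?thesis
      by (rule rtrancl_on_mono[rotated -1]) (auto simp: symcl_def)
  qed
  then show ?thesis
    using assms by (auto simp: connected_conv strongly_connected_def)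
qed

text \<open>Adding arcs cannot disconnect; hence maximal connected subgraphs are induced.\<close>

lemma arc_mono_connected: "arc_mono Digraph_Component.connected"
  unfolding arc_mono_def
  by (metis spanning_def subgraphE wf_digraph.connected_spanning_imp_connected)

text \<open>An induced subgraph inherits symmetry, so a maximal connected one is strongly connected;
  it stays maximal because strongly connected subgraphs are connected.\<close>

lemma (in sym_digraph) components_subset_sccs_verts: "components G \<subseteq> sccs_verts"
proof
  fix D assume "D \<in> components G"
  then obtain C where C: "D = verts C" "max_subgraph Digraph_Component.connected C"
    by (auto simp: components_def)
  then have "induced_subgraph C G"
    using induced_subgraphI_arc_mono arc_mono_connected by blast
  then interpret C: sym_digraph C
    by (rule induced_graph_imp_graph)
  have "strongly_connected C"
    using C C.symmetric_connected_imp_strongly_connected[OF C.sym_arcs] max_subgraph_prop by blast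
  then have "max_subgraph strongly_connected C"
    using max_subgraph_mp C(2) strongly_connected_imp_connected by blast
  then show "D \<in> sccs_verts"
    using C(1) by (auto simp: sccs_altdef2 sccs_verts_conv)
qed

text \<open>By symmetry an arc within \<open>S\<close> makes its ends mutually reachable, so a
  component contains both or neither.\<close>

lemma (in sym_digraph) component_closed:
  assumes "S \<subseteq> verts G" and D: "D \<in> components (G \<restriction> S)"
  shows "D \<noteq> {}" "D \<subseteq> S" "\<And>i j. i \<in> D \<Longrightarrow> i \<rightarrow> j \<Longrightarrow> j \<in> S \<Longrightarrow> j \<in> D"
proof -
  interpret H: sym_digraph "G \<restriction> S"
    using assms(1) by (intro induced_graph_imp_graph induced_induce)
  have S: "D \<in> H.sccs_verts"
    using D H.components_subset_sccs_verts by blast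
  then show "D \<noteq> {}" by (simp add: H.in_sccs_verts_conv_reachable)
  show "D \<subseteq> S" using H.sccs_verts_subsets[OF S] by simp
  fix i j assume "i \<in> D" "i \<rightarrow> j" "j \<in> S"
  with \<open>D \<subseteq> S\<close> have e: "i \<rightarrow>\<^bsub>G \<restriction> S\<^esub> j"
    by (force simp: arcs_ends_def arc_to_ends_def)
  then have "i \<rightarrow>\<^sup>*\<^bsub>G \<restriction> S\<^esub> j" "j \<rightarrow>\<^sup>*\<^bsub>G \<restriction> S\<^esub> i"
    using H.graph_symmetric by (auto intro: H.adj_reachable_trans)
  then show "j \<in> D"
    using S \<open>i \<in> D\<close> by (auto simp: H.in_sccs_verts_conv_reachable)
qed

text \<open>A path to a second vertex starts with an arc out of \<open>i\<close>. Positive degrees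
  make the volumes of nodal domains positive.\<close>

lemma (in graph) degree_pos:
  assumes "Digraph_Component.connected G" "i \<in> verts G" "k \<in> verts G" "i \<noteq> k"
  shows "degree G i > 0"
proof -
  have "i \<rightarrow>\<^sup>* k"
    using symmetric_connected_imp_strongly_connected[OF sym_arcs] assms by auto
  then obtain j where "i \<rightarrow> j"
    using \<open>i \<noteq> k\<close> by (cases rule: converse_reachable_cases) auto
  then have "out_arcs G i \<noteq> {}"
    by (auto simp: out_arcs_def)
  moreover have "finite (out_arcs G i)"
    by (simp add: out_arcs_def)
  ultimately show ?thesis
    by (simp add: degree_def out_degree_def card_gt_0_iff)
qed

theorem theorem1:
  fixes G :: "('n::finite, 'b) pre_digraph" and x :: "real ^ 'n" and \<mu> :: real
  assumes "graph G" and "verts G = UNIV" and "CARD('n) \<ge> 2"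
    and "Digraph_Component.connected G"
    and "x \<in> unit_set G" and "x \<in> eigenvectors G" and "\<mu> = tvar G x"
  shows "(\<forall>D \<in> pos_nodal_domains G x. path_equiv G (eigenvectors G \<inter> tvar G -` {\<mu>}) x (hat_indicator G D)) \<and>
    (\<forall>D \<in> neg_nodal_domains G x. path_equiv G (eigenvectors G \<inter> tvar G -` {\<mu>}) x (- hat_indicator G D))"
proof -
  interpret graph G by fact
  \<comment> \<open>Membership in \<open>eigenvectors\<close> gives some eigenvalue; normalisation
    of \<open>x\<close> identifies it with \<open>\<mu>\<close>.\<close>
  obtain z s where w: "eigen_witness G \<mu> z s x"
    using assms(5-7) eigenvalue_eq_tvar[OF assms(1)] by (auto simp: eigenvectors_def eigenpair_iff_witness)
  have deg: "degree G i > 0" for i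
  proof -
    have "UNIV \<noteq> {i}"
    proof
      assume "UNIV = {i}"
      then have "CARD('n) = card {i}" by (rule arg_cong)
      with assms(3) show False by simp
    qed
    then obtain k where "k \<noteq> i" by auto
    then show ?thesis
      using degree_pos[of i k] assms(2,4) by simp
  qed
  have signed: "path_equiv G (eigenvectors G \<inter> tvar G -` {\<mu>}) x (\<sigma> *\<^sub>R hat_indicator G D)"
    if \<sigma>: "\<sigma> = 1 \<or> \<sigma> = -1" and D: "D \<in> components (G \<restriction> {i. \<sigma> * x $ i > 0})" for \<sigma> D
  proof (rule segment_path_equiv[OF assms(1) w assms(5)])
    note D' = component_closed[OF _ D, unfolded assms(2), OF subset_UNIV]
    show "eigen_witness G \<mu> z s (\<sigma> *\<^sub>R hat_indicator G D)"
    proof (rule eigen_witness_signed_indicator[OF w \<sigma>])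
      show "\<sigma> * x $ i > 0" if "i \<in> D" for i
        using D'(2) that by auto
      \<comment> \<open>A neighbour \<open>j\<close> with \<open>\<sigma> * x $ j > 0\<close> would
        be absorbed into \<open>D\<close>.\<close>
      show "\<sigma> * x $ j \<le> 0" if "i \<in> D" "j \<notin> D" "i \<rightarrow>\<^bsub>G\<^esub> j \<or> j \<rightarrow>\<^bsub>G\<^esub> i" for i j
        using D'(3)[of i j] that graph_symmetric by force
    qed
    have "vol G D > 0"
      using D'(1) deg by (auto simp: vol_def intro!: sum_pos)
    then show "\<sigma> *\<^sub>R hat_indicator G D \<in> unit_set G"
      using \<sigma> by (intro signed_indicator_in_unit_set) auto
  qed
  show ?thesis
    using signed[of 1] signed[of "-1"]
    by (simp add: pos_nodal_domains_def neg_nodal_domains_def)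
qed

end
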